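(* Let $(X,\Sigma,\mu)$ be a $\sigma$-finite measure space, let $u:X\to\mathbb{C}$ be $\Sigma$-measurable, and let $\phi:X\to X$ be a measurable map with $\mu\circ\phi^{-1}\ll\mu$ and with $\mu|_{\phi^{-1}(\Sigma)}$ $\sigma$-finite. Let $uC_\phi$ be the weighted composition operator in $L^2(\mu)$, and let $J_i$ ($i\ge 0$) and $\triangle_{J,i}$ be the associated functions. Suppose $\mathcal{D}((uC_\phi)^2)$ is dense in $L^2(\mu)$ and let $k\ge 1$ be fixed. Then: (i) $uC_\phi$ is $k$-hyperexpansive if and only if $\triangle_{J,i}(x)\le 0$ for $\mu$-a.e. $x$, for every $i=1,\dots,k$. (ii) $uC_\phi$ is completely hyperexpansive if and only if, for $\mu$-almost every $x\in X$, the sequence $\{J_i(x)\}_{i=0}^\infty$ is completely alternating.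
   Context: An operator $T$ in a Hilbert space $\mathcal{H}$ is a linear map $T:\mathcal{D}(T)\to\mathcal{H}$ on a linear subspace $\mathcal{D}(T)\subseteq\mathcal{H}$; powers $T^n$ have their natural domains. The weighted composition operator $uC_\phi$ in $L^2(\mu)=L^2(X,\Sigma,\mu)$ has domain $\mathcal{D}(uC_\phi)=\{f\in L^2(\mu): u\cdot (f\circ\phi)\in L^2(\mu)\}$ and acts by $uC_\phi(f)=u\cdot (f\circ\phi)$. Let $h=\frac{d(\mu\circ\phi^{-1})}{d\mu}$, and let $E$ be the conditional expectation with respect to $\phi^{-1}(\Sigma)$ (defined on nonnegative measurable functions). For measurable $g\ge 0$, $E(g)=G\circ\phi$ for some $\Sigma$-measurable $G\ge0$, and $hE(g)\circ\phi^{-1}$ denotes $h\cdot G$ (well defined $\mu$-a.e.; equivalently $\int_A hE(g)\circ\phi^{-1}\,d\mu=\int_{\phi^{-1}(A)}g\,d\mu$ for all $A\in\Sigma$). Put $J_0=1$ and $J_n=hE(J_{n-1}|u|^2)\circ\phi^{-1}$ for $n\ge1$, with values in $[0,\infty]$. When $J_1,\dots,J_n$ are finite valued ($\mu$-a.e.), $\triangle_{J,n}(x)=\sum_{0\le i\le n}(-1)^i\binom{n}{i}J_i(x)$; a condition on $\triangle_{J,n}$ includes that it is defined. For an operator $T$ and $n\ge1$, $\Theta_{T,n}(f)=\sum_{0\le i\le n}(-1)^i\binom{n}{i}\|T^i f\|^2$ for $f\in\mathcal{D}(T^n)$. $T$ is $k$-hyperexpansive if $\Theta_{T,n}(f)\le0$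 for all $f\in\mathcal{D}(T^n)$ and $n=1,\dots,k$; completely hyperexpansive if $\Theta_{T,n}(f)\le 0$ for all $f\in\mathcal{D}(T^n)$ and all $n\ge1$. A real sequence $\{\varphi(i)\}_{i=0}^\infty$ is completely alternating if $\sum_{0\le i\le n}(-1)^i\binom{n}{i}\varphi(m+i)\le0$ for all $m\ge0$ and $n\ge1$. *)

theory Defs
  imports "HOL-Probability.Probability"
begin

text \<open>
  An operator in a normed space is given by the ambient space \<open>H\<close> (a set of vectors), its
  domain \<open>D\<close> and a map \<open>T\<close>, of which only the values on \<open>D\<close> matter.
\<close>

primrec pow_dom :: "'v set \<Rightarrow> 'v set \<Rightarrow> ('v \<Rightarrow> 'v) \<Rightarrow> nat \<Rightarrow> 'v set" where
  "pow_dom H D T 0 = H"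
| "pow_dom H D T (Suc n) = {f \<in> D. T f \<in> pow_dom H D T n}"

definition Theta :: "('v \<Rightarrow> real) \<Rightarrow> ('v \<Rightarrow> 'v) \<Rightarrow> nat \<Rightarrow> 'v \<Rightarrow> real" where
  "Theta nrm T n f = (\<Sum>i\<le>n. (-1) ^ i * real (n choose i) * (nrm ((T ^^ i) f))\<^sup>2)"

definition k_hyperexpansive ::
  "'v set \<Rightarrow> ('v \<Rightarrow> real) \<Rightarrow> 'v set \<Rightarrow> ('v \<Rightarrow> 'v) \<Rightarrow> nat \<Rightarrow> bool" where
  "k_hyperexpansive H nrm D T k \<longleftrightarrow>
     (\<forall>n\<in>{1..k}. \<forall>f\<in>pow_dom H D T n. Theta nrm T n f \<le> 0)"

definition completely_hyperexpansive ::
  "'v set \<Rightarrow> ('v \<Rightarrow> real) \<Rightarrow> 'v set \<Rightarrow> ('v \<Rightarrow> 'v) \<Rightarrow> bool" where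
  "completely_hyperexpansive H nrm D T \<longleftrightarrow>
     (\<forall>n\<ge>1. \<forall>f\<in>pow_dom H D T n. Theta nrm T n f \<le> 0)"

definition completely_alternating :: "(nat \<Rightarrow> real) \<Rightarrow> bool" where
  "completely_alternating a \<longleftrightarrow>
     (\<forall>m. \<forall>n\<ge>1. (\<Sum>i\<le>n. (-1) ^ i * real (n choose i) * a (m + i)) \<le> 0)"

text \<open>
  Elements of $L^2(\mu)$ are represented by square-integrable functions instead of their classes
  modulo almost everywhere equality; accordingly \<open>L2_norm\<close> is a seminorm on \<open>L2_space\<close>.
  When $\mu\circ\phi^{-1}\ll\mu$, the map \<open>wco\<close> and its domain respect almost everywhere equality.
\<close>

definition L2_space :: "'a measure \<Rightarrow> ('a \<Rightarrow> complex) set" where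
  "L2_space M = {f \<in> borel_measurable M. integrable M (\<lambda>x. (cmod (f x))\<^sup>2)}"

definition L2_norm :: "'a measure \<Rightarrow> ('a \<Rightarrow> complex) \<Rightarrow> real" where
  "L2_norm M f = sqrt (\<integral>x. (cmod (f x))\<^sup>2 \<partial>M)"

definition L2_dense :: "'a measure \<Rightarrow> ('a \<Rightarrow> complex) set \<Rightarrow> bool" where
  "L2_dense M A \<longleftrightarrow> (\<forall>f\<in>L2_space M. \<forall>e>0. \<exists>g\<in>A. L2_norm M (\<lambda>x. f x - g x) < e)"

definition wco :: "('a \<Rightarrow> complex) \<Rightarrow> ('a \<Rightarrow> 'a) \<Rightarrow> ('a \<Rightarrow> complex) \<Rightarrow> 'a \<Rightarrow> complex" where
  "wco u \<phi> f = (\<lambda>x. u x * f (\<phi> x))"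

definition wco_dom :: "'a measure \<Rightarrow> ('a \<Rightarrow> complex) \<Rightarrow> ('a \<Rightarrow> 'a) \<Rightarrow> ('a \<Rightarrow> complex) set" where
  "wco_dom M u \<phi> = {f \<in> L2_space M. wco u \<phi> f \<in> L2_space M}"

text \<open>The $\sigma$-algebra $\phi^{-1}(\Sigma)$; as a measure it carries no information.\<close>

definition preimage_algebra :: "'a measure \<Rightarrow> ('a \<Rightarrow> 'a) \<Rightarrow> 'a measure" where
  "preimage_algebra M \<phi> = vimage_algebra (space M) \<phi> M"

text \<open>
  \<open>hE_inv M \<phi> g\<close> is $h\,E(g)\circ\phi^{-1} = h\cdot G$ for a chosen measurable $G$ with
  $E(g) = G\circ\phi$. Any two such $G$ agree almost everywhere on $\{h > 0\}$, so the product
  (with $0\cdot\infty = 0$) does not depend on the choice, up to null sets.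
\<close>

definition hE_inv :: "'a measure \<Rightarrow> ('a \<Rightarrow> 'a) \<Rightarrow> ('a \<Rightarrow> ennreal) \<Rightarrow> 'a \<Rightarrow> ennreal" where
  "hE_inv M \<phi> g =
     (let h = RN_deriv M (distr M M \<phi>);
          G = (SOME G. G \<in> borel_measurable M \<and>
                 (AE x in M. nn_cond_exp M (preimage_algebra M \<phi>) g x = G (\<phi> x)))
      in (\<lambda>x. h x * G x))"

primrec J :: "'a measure \<Rightarrow> ('a \<Rightarrow> complex) \<Rightarrow> ('a \<Rightarrow> 'a) \<Rightarrow> nat \<Rightarrow> 'a \<Rightarrow> ennreal" where
  "J M u \<phi> 0 = (\<lambda>x. 1)"
| "J M u \<phi> (Suc n) = hE_inv M \<phi> (\<lambda>x. J M u \<phi> n x * ennreal ((cmod (u x))\<^sup>2))"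

text \<open>\<open>triangle_J\<close> is meaningful only under \<open>triangle_J_defined\<close>: \<open>enn2real\<close> sends $\infty$ to $0$.\<close>

definition triangle_J_defined ::
  "'a measure \<Rightarrow> ('a \<Rightarrow> complex) \<Rightarrow> ('a \<Rightarrow> 'a) \<Rightarrow> nat \<Rightarrow> bool" where
  "triangle_J_defined M u \<phi> n \<longleftrightarrow> (\<forall>i\<in>{1..n}. AE x in M. J M u \<phi> i x < \<infinity>)"

definition triangle_J ::
  "'a measure \<Rightarrow> ('a \<Rightarrow> complex) \<Rightarrow> ('a \<Rightarrow> 'a) \<Rightarrow> nat \<Rightarrow> 'a \<Rightarrow> real" where
  "triangle_J M u \<phi> n x = (\<Sum>i\<le>n. (-1) ^ i * real (n choose i) * enn2real (J M u \<phi> i x))"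

end

(*
  The defining property of J gives |T^i f|^2 = integral of J_i |f|^2 for T = u C_phi, so that
  Theta_n(f) is the integral of triangle_n |f|^2 as soon as J_1, ..., J_n are finite. Testing with
  indicators of sets on which these J_i are bounded makes Theta_n <= 0 on D(T^n) equivalent to
  triangle_n <= 0 a.e.  Density of D(T^2) gives the finiteness of J_1 and J_2 only.  An alternating
  inequality between the J_i is therefore written without subtraction, as an inequality between
  the even and the odd terms in [0, infinity]; in this form the positive operator that maps J_n to
  J_(n+1) preserves it.  Hence J_n + J_(n+2) <= 2 J_(n+1) for all n, so all J_n are finite, and
  triangle_n <= 0 for all n makes the whole sequence completely alternating.
*)

theory Submission
  imports Defs
begin

section \<open>Almost everywhere comparison, and factorization through a map\<close>

text \<open>Infinite integrals rule out subtracting. Instead \<open>max f g\<close> and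
  \<open>g\<close> are shown to be densities of one measure: where \<open>g < f\<close> the maximum
  is \<open>f\<close>, and the hypothesis on that part of a set bounds it by \<open>g\<close>.
  Densities over a sigma-finite measure are unique almost everywhere.\<close>

lemma (in sigma_finite_measure) AE_le_nn_integralI:
  fixes f g :: "'a \<Rightarrow> ennreal"
  assumes [measurable]: "f \<in> borel_measurable M" "g \<in> borel_measurable M"
    and le: "\<And>A. A \<in> sets M \<Longrightarrow> (\<integral>\<^sup>+x. indicator A x * f x \<partial>M) \<le> (\<integral>\<^sup>+x. indicator A x * g x \<partial>M)"
  shows "AE x in M. f x \<le> g x"
proof -
  let ?m = "\<lambda>x. max (f x) (g x)"
  have "density M ?m = density M g"
  proof (rule measure_eqI)
    fix A assume "A \<in> sets (density M ?m)"
    then have [measurable]: "A \<in> sets M" by simp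
    define B where "B = {x \<in> space M. g x < f x}"
    have [measurable]: "B \<in> sets M" unfolding B_def by measurable
    have "(\<integral>\<^sup>+x. ?m x * indicator A x \<partial>M)
        = (\<integral>\<^sup>+x. indicator (A \<inter> B) x * f x + indicator (A - B) x * g x \<partial>M)"
      by (rule nn_integral_cong) (auto simp: B_def max_def not_le split: split_indicator)
    also have "\<dots> = (\<integral>\<^sup>+x. indicator (A \<inter> B) x * f x \<partial>M) + (\<integral>\<^sup>+x. indicator (A - B) x * g x \<partial>M)"
      by (rule nn_integral_add) auto
    also have "\<dots> \<le> (\<integral>\<^sup>+x. indicator (A \<inter> B) x * g x \<partial>M) + (\<integral>\<^sup>+x. indicator (A - B) x * g x \<partial>M)"
      by (intro add_right_mono le) auto
    also have "\<dots> = (\<integral>\<^sup>+x. indicator (A \<inter> B) x * g x + indicator (A - B) x * g x \<partial>M)"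
      by (rule nn_integral_add[symmetric]) auto
    also have "\<dots> = (\<integral>\<^sup>+x. g x * indicator A x \<partial>M)"
      by (rule nn_integral_cong) (auto split: split_indicator)
    finally have "(\<integral>\<^sup>+x. ?m x * indicator A x \<partial>M) \<le> (\<integral>\<^sup>+x. g x * indicator A x \<partial>M)" .
    moreover have "(\<integral>\<^sup>+x. g x * indicator A x \<partial>M) \<le> (\<integral>\<^sup>+x. ?m x * indicator A x \<partial>M)"
      by (intro nn_integral_mono mult_right_mono) auto
    ultimately show "emeasure (density M ?m) A = emeasure (density M g) A"
      by (simp add: emeasure_density)
  qed simp
  then have "AE x in M. ?m x = g x"
    by (intro density_unique) auto
  then show ?thesis by eventually_elim (metis max.cobounded1)
qed

text \<open>The Doob-Dynkin factorization for \<open>[0, \<infinity>]\<close>-valued functions.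
  Indicators of preimages come from indicators, and sums, multiples and suprema of sequences pass to
  the factors. It supplies the \<open>G\<close> with \<open>E(g) = G \<circ> \<phi>\<close> that the
  definition of \<open>hE_inv\<close> chooses.\<close>

lemma borel_measurable_vimage_algebra_factor:
  fixes f :: "'a \<Rightarrow> ennreal"
  assumes \<phi>: "\<phi> \<in> X \<rightarrow> space M" and f: "f \<in> borel_measurable (vimage_algebra X \<phi> M)"
  shows "\<exists>G\<in>borel_measurable M. \<forall>x\<in>X. f x = G (\<phi> x)"
  using f
proof (induction rule: borel_measurable_induct)
  case (cong f g)
  then show ?case by auto
next
  case (set A)
  then obtain B where B: "B \<in> sets M" "A = \<phi> -` B \<inter> X"
    using \<phi> by (auto simp: sets_vimage_algebra2)
  then show ?case
    by (intro bexI[of _ "indicator B"]) (auto split: split_indicator)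
next
  case (mult f c)
  then obtain G where "G \<in> borel_measurable M" "\<forall>x\<in>X. f x = G (\<phi> x)" by blast
  then show ?case by (intro bexI[of _ "\<lambda>x. c * G x"]) auto
next
  case (add f g)
  then obtain F G where "F \<in> borel_measurable M" "\<forall>x\<in>X. f x = F (\<phi> x)"
    "G \<in> borel_measurable M" "\<forall>x\<in>X. g x = G (\<phi> x)" by blast
  then show ?case by (intro bexI[of _ "\<lambda>x. G x + F x"]) auto
next
  case (seq U)
  then have "\<forall>i. \<exists>G\<in>borel_measurable M. \<forall>x\<in>X. U i x = G (\<phi> x)" by blast
  then obtain G where G: "\<And>i. G i \<in> borel_measurable M" "\<And>i x. x \<in> X \<Longrightarrow> U i x = G i (\<phi> x)"
    by metis
  then show ?case
    by (intro bexI[of _ "\<lambda>x. SUP i. G i x"]) (auto simp: image_comp)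
qed

section \<open>Alternating binomial sums with values in \<open>[0, \<infinity>]\<close>\<close>

definition even_part :: "nat \<Rightarrow> (nat \<Rightarrow> ennreal) \<Rightarrow> ennreal" where
  "even_part n a = (\<Sum>i\<in>{i. i \<le> n \<and> even i}. of_nat (n choose i) * a i)"

definition odd_part :: "nat \<Rightarrow> (nat \<Rightarrow> ennreal) \<Rightarrow> ennreal" where
  "odd_part n a = (\<Sum>i\<in>{i. i \<le> n \<and> odd i}. of_nat (n choose i) * a i)"

text \<open>For finite values both parts are images of real sums, whose difference is the
  alternating sum. Finiteness matters because \<open>enn2real\<close> would replace an infinite
  value by 0.\<close>

lemma alternating_sum_le_0_iff:
  assumes fin: "\<And>i. i \<le> n \<Longrightarrow> a i < \<infinity>"
  shows "(\<Sum>i\<le>n. (-1) ^ i * real (n choose i) * enn2real (a i)) \<le> 0 \<longleftrightarrow> even_part n a \<le> odd_part n a"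
proof -
  let ?r = "\<lambda>i. real (n choose i) * enn2real (a i)"
  let ?E = "{i. i \<le> n \<and> even i}" and ?O = "{i. i \<le> n \<and> odd i}"
  have "(\<Sum>i\<le>n. (-1) ^ i * real (n choose i) * enn2real (a i))
      = (\<Sum>i\<in>?E \<union> ?O. (-1) ^ i * real (n choose i) * enn2real (a i))"
    by (rule sum.cong) auto
  also have "\<dots> = (\<Sum>i\<in>?E. (-1) ^ i * real (n choose i) * enn2real (a i))
      + (\<Sum>i\<in>?O. (-1) ^ i * real (n choose i) * enn2real (a i))"
    by (rule sum.union_disjoint) auto
  also have "(\<Sum>i\<in>?E. (-1) ^ i * real (n choose i) * enn2real (a i)) = (\<Sum>i\<in>?E. ?r i)"
    by (rule sum.cong) auto
  also have "(\<Sum>i\<in>?O. (-1) ^ i * real (n choose i) * enn2real (a i)) = - (\<Sum>i\<in>?O. ?r i)"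
    unfolding sum_negf[symmetric] by (rule sum.cong) auto
  finally have *: "(\<Sum>i\<le>n. (-1) ^ i * real (n choose i) * enn2real (a i)) = (\<Sum>i\<in>?E. ?r i) - (\<Sum>i\<in>?O. ?r i)"
    by simp
  have ennreal_r: "of_nat (n choose i) * a i = ennreal (?r i)" if "i \<le> n" for i
    using fin[OF that] by (simp add: ennreal_mult ennreal_of_nat_eq_real_of_nat)
  have "even_part n a = (\<Sum>i\<in>?E. ennreal (?r i))" "odd_part n a = (\<Sum>i\<in>?O. ennreal (?r i))"
    unfolding even_part_def odd_part_def by (auto intro!: sum.cong simp: ennreal_r)
  then have "even_part n a = ennreal (\<Sum>i\<in>?E. ?r i)" "odd_part n a = ennreal (\<Sum>i\<in>?O. ?r i)"
    by (simp_all add: sum_ennreal)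
  then show ?thesis
    unfolding * by (simp add: ennreal_le_iff sum_nonneg)
qed

section \<open>The square-integral seminorm as an integral in
  \<open>[0, \<infinity>]\<close>\<close>

lemma L2_norm_sq:
  assumes "f \<in> borel_measurable M"
  shows "(L2_norm M f)\<^sup>2 = enn2real (\<integral>\<^sup>+x. ennreal ((cmod (f x))\<^sup>2) \<partial>M)"
  using assms unfolding L2_norm_def
  by (simp add: integral_eq_nn_integral)

lemma L2_space_iff:
  "f \<in> L2_space M \<longleftrightarrow> f \<in> borel_measurable M \<and> (\<integral>\<^sup>+x. ennreal ((cmod (f x))\<^sup>2) \<partial>M) < \<infinity>"
  unfolding L2_space_def by (auto simp: integrable_iff_bounded)

text \<open>A small \<open>L2_norm\<close> alone does not bound the extended integral, since the
  Bochner integral of a non-integrable function is 0. So the integral of \<open>|f - g|^2\<close> is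
  first shown to be finite, from \<open>|f - g|^2 \<le> 2|f|^2 + 2|g|^2\<close>.\<close>

lemma L2_dense_ennrealE:
  assumes "L2_dense M D" "D \<subseteq> L2_space M" "f \<in> L2_space M" "e > 0"
  obtains g where "g \<in> D" "(\<integral>\<^sup>+x. ennreal ((cmod (f x - g x))\<^sup>2) \<partial>M) < ennreal e"
proof -
  obtain g where g: "g \<in> D" "L2_norm M (\<lambda>x. f x - g x) < sqrt e"
    using assms(1,3) real_sqrt_gt_zero[OF assms(4)] unfolding L2_dense_def by blast
  have "g \<in> L2_space M" using g(1) assms(2) by blast
  then have meas [measurable]: "f \<in> borel_measurable M" "g \<in> borel_measurable M"
    using assms(3) by (simp_all add: L2_space_iff)
  have fin: "(\<integral>\<^sup>+x. ennreal ((cmod (f x))\<^sup>2) \<partial>M) < \<infinity>" "(\<integral>\<^sup>+x. ennreal ((cmod (g x))\<^sup>2) \<partial>M) < \<infinity>"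
    using assms(3) \<open>g \<in> L2_space M\<close> by (simp_all add: L2_space_iff)
  have "(\<integral>\<^sup>+x. ennreal ((cmod (f x - g x))\<^sup>2) \<partial>M)
      \<le> (\<integral>\<^sup>+x. 2 * ennreal ((cmod (f x))\<^sup>2) + 2 * ennreal ((cmod (g x))\<^sup>2) \<partial>M)"
  proof (rule nn_integral_mono)
    fix x
    have "(cmod (f x - g x))\<^sup>2 \<le> (cmod (f x) + cmod (g x))\<^sup>2"
      by (intro power_mono norm_triangle_ineq4) auto
    \<comment> \<open>This is \<open>(|f x| - |g x|)^2 \<ge> 0\<close> rearranged.\<close>
    also have "\<dots> \<le> 2 * (cmod (f x))\<^sup>2 + 2 * (cmod (g x))\<^sup>2"
      using sum_squares_ge_zero[of "cmod (f x) - cmod (g x)" 0] by (simp add: power2_eq_square algebra_simps)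
    finally have "ennreal ((cmod (f x - g x))\<^sup>2) \<le> ennreal (2 * (cmod (f x))\<^sup>2 + 2 * (cmod (g x))\<^sup>2)"
      by (rule ennreal_leI)
    also have "\<dots> = 2 * ennreal ((cmod (f x))\<^sup>2) + 2 * ennreal ((cmod (g x))\<^sup>2)"
      by (simp add: ennreal_plus ennreal_mult)
    finally show "ennreal ((cmod (f x - g x))\<^sup>2) \<le> 2 * ennreal ((cmod (f x))\<^sup>2) + 2 * ennreal ((cmod (g x))\<^sup>2)" .
  qed
  also have "\<dots> = 2 * (\<integral>\<^sup>+x. ennreal ((cmod (f x))\<^sup>2) \<partial>M) + 2 * (\<integral>\<^sup>+x. ennreal ((cmod (g x))\<^sup>2) \<partial>M)"
    by (simp add: nn_integral_add nn_integral_cmult)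
  also have "\<dots> < \<infinity>" using fin by (simp add: ennreal_mult_less_top)
  finally have "(\<integral>\<^sup>+x. ennreal ((cmod (f x - g x))\<^sup>2) \<partial>M) = ennreal (enn2real (\<integral>\<^sup>+x. ennreal ((cmod (f x - g x))\<^sup>2) \<partial>M))"
    by simp
  also have "\<dots> = ennreal ((L2_norm M (\<lambda>x. f x - g x))\<^sup>2)"
    by (simp only: L2_norm_sq[OF borel_measurable_diff[OF meas]])
  also have "\<dots> < ennreal e"
  proof (rule ennreal_lessI)
    have "0 \<le> L2_norm M (\<lambda>x. f x - g x)" by (simp add: L2_norm_def)
    then have "(L2_norm M (\<lambda>x. f x - g x))\<^sup>2 < (sqrt e)\<^sup>2"
      using g(2) by (intro power_strict_mono) simp_all
    then show "(L2_norm M (\<lambda>x. f x - g x))\<^sup>2 < e" using \<open>e > 0\<close> by simp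
  qed fact
  finally have "(\<integral>\<^sup>+x. ennreal ((cmod (f x - g x))\<^sup>2) \<partial>M) < ennreal e" .
  then show ?thesis by (rule that[OF g(1)])
qed

section \<open>The operator, its powers and the functions \<open>J\<close>\<close>

locale weighted_composition =
  fixes M :: "'a measure" and u :: "'a \<Rightarrow> complex" and \<phi> :: "'a \<Rightarrow> 'a"
  assumes sigma_finite: "sigma_finite_measure M"
    and u [measurable]: "u \<in> borel_measurable M"
    and \<phi> [measurable]: "\<phi> \<in> measurable M M"
    and ac: "absolutely_continuous M (distr M M \<phi>)"
    and sigma_finite_sub: "sigma_finite_measure (restr_to_subalg M (preimage_algebra M \<phi>))"
begin

sublocale sigma_finite_measure M
  by (rule sigma_finite)

abbreviation "T \<equiv> wco u \<phi>"
abbreviation "D n \<equiv> pow_dom (L2_space M) (wco_dom M u \<phi>) (wco u \<phi>) n"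
abbreviation "Jn \<equiv> J M u \<phi>"
abbreviation "sq f \<equiv> \<lambda>x. ennreal ((cmod (f x))\<^sup>2)"

lemma subalgebra_preimage: "subalgebra M (preimage_algebra M \<phi>)"
  unfolding subalgebra_def preimage_algebra_def
  using measurable_space[OF \<phi>] by (auto simp: sets_vimage_algebra2)

sublocale sub: sigma_finite_subalgebra M "preimage_algebra M \<phi>"
  by (rule sigma_finite_subalgebra.intro[OF subalgebra_preimage sigma_finite_sub])

text \<open>By these two facts \<open>hE_inv\<close> is handled from here on; the choice of
  \<open>G\<close> is not opened again. The factor \<open>h\<close> turns the integral into one over
  the image measure, the change of variables produces \<open>G \<circ> \<phi> = E(g)\<close>, and
  \<open>E\<close> drops out against \<open>F \<circ> \<phi>\<close>, which is measurable for the
  preimage algebra.\<close>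

lemma
  assumes g [measurable]: "g \<in> borel_measurable M"
  shows borel_measurable_hE_inv [measurable]: "hE_inv M \<phi> g \<in> borel_measurable M"
    and nn_integral_hE_inv: "F \<in> borel_measurable M \<Longrightarrow>
      (\<integral>\<^sup>+x. F x * hE_inv M \<phi> g x \<partial>M) = (\<integral>\<^sup>+x. F (\<phi> x) * g x \<partial>M)"
proof -
  let ?E = "nn_cond_exp M (preimage_algebra M \<phi>) g"
  let ?P = "\<lambda>G. G \<in> borel_measurable M \<and> (AE x in M. ?E x = G (\<phi> x))"
  define h where "h = RN_deriv M (distr M M \<phi>)"
  define G where "G = (SOME G. ?P G)"
  have "?E \<in> borel_measurable (vimage_algebra (space M) \<phi> M)"
    using borel_measurable_nn_cond_exp[of M "preimage_algebra M \<phi>" g] by (simp add: preimage_algebra_def)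
  then have "\<exists>G. ?P G"
    using borel_measurable_vimage_algebra_factor[of \<phi> "space M" M ?E] measurable_space[OF \<phi>]
    by (auto intro!: AE_I2)
  then have "?P G" unfolding G_def by (rule someI_ex)
  then have G [measurable]: "G \<in> borel_measurable M" and EG: "AE x in M. ?E x = G (\<phi> x)" by auto
  have hE: "hE_inv M \<phi> g = (\<lambda>x. h x * G x)"
    unfolding hE_inv_def h_def G_def Let_def ..
  have [measurable]: "h \<in> borel_measurable M" by (simp add: h_def)
  show "hE_inv M \<phi> g \<in> borel_measurable M" unfolding hE by measurable
  show "(\<integral>\<^sup>+x. F x * hE_inv M \<phi> g x \<partial>M) = (\<integral>\<^sup>+x. F (\<phi> x) * g x \<partial>M)"
    if F [measurable]: "F \<in> borel_measurable M"
  proof -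
    have F\<phi>: "(\<lambda>x. F (\<phi> x)) \<in> borel_measurable (preimage_algebra M \<phi>)"
      unfolding preimage_algebra_def
      by (rule measurable_compose[OF measurable_vimage_algebra1 F]) (use measurable_space[OF \<phi>] in auto)
    have "(\<integral>\<^sup>+x. F x * hE_inv M \<phi> g x \<partial>M) = (\<integral>\<^sup>+x. h x * (F x * G x) \<partial>M)"
      unfolding hE by (simp add: ac_simps)
    also have "\<dots> = (\<integral>\<^sup>+x. F x * G x \<partial>distr M M \<phi>)"
      unfolding h_def by (rule RN_deriv_nn_integral[symmetric]) (use ac in auto)
    also have "\<dots> = (\<integral>\<^sup>+x. F (\<phi> x) * G (\<phi> x) \<partial>M)"
      by (rule nn_integral_distr) auto
    also have "\<dots> = (\<integral>\<^sup>+x. F (\<phi> x) * ?E x \<partial>M)"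
      by (rule nn_integral_cong_AE) (use EG in auto)
    also have "\<dots> = (\<integral>\<^sup>+x. F (\<phi> x) * g x \<partial>M)"
      by (rule sub.nn_cond_exp_intg[OF F\<phi> g])
    finally show ?thesis .
  qed
qed

lemma borel_measurable_J [measurable]: "Jn n \<in> borel_measurable M"
  by (induction n) auto

lemma nn_integral_J_Suc:
  assumes [measurable]: "F \<in> borel_measurable M"
  shows "(\<integral>\<^sup>+x. F x * Jn (Suc n) x \<partial>M) = (\<integral>\<^sup>+x. F (\<phi> x) * (Jn n x * sq u x) \<partial>M)"
  by (simp add: nn_integral_hE_inv)

lemma borel_measurable_wco [measurable]: "f \<in> borel_measurable M \<Longrightarrow> T f \<in> borel_measurable M"
  unfolding wco_def by (intro borel_measurable_times u measurable_compose[OF \<phi>])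

text \<open>Since \<open>|T f|^2 = |u|^2 (|f|^2 \<circ> \<phi>)\<close>, the recursion for
  \<open>J\<close> trades one application of \<open>T\<close> for one step of the index.\<close>

lemma nn_integral_J_wco:
  assumes [measurable]: "f \<in> borel_measurable M"
  shows "(\<integral>\<^sup>+x. sq (T f) x * Jn n x \<partial>M) = (\<integral>\<^sup>+x. sq f x * Jn (Suc n) x \<partial>M)"
proof -
  have "(\<integral>\<^sup>+x. sq (T f) x * Jn n x \<partial>M) = (\<integral>\<^sup>+x. sq f (\<phi> x) * (Jn n x * sq u x) \<partial>M)"
    by (rule nn_integral_cong) (simp add: wco_def norm_mult power_mult_distrib ennreal_mult ac_simps)
  also have "\<dots> = (\<integral>\<^sup>+x. sq f x * Jn (Suc n) x \<partial>M)"
    by (rule nn_integral_J_Suc[symmetric]) measurable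
  finally show ?thesis .
qed

lemma nn_integral_wco_funpow:
  assumes "f \<in> borel_measurable M"
  shows "(T ^^ n) f \<in> borel_measurable M
    \<and> (\<integral>\<^sup>+x. sq ((T ^^ n) f) x \<partial>M) = (\<integral>\<^sup>+x. sq f x * Jn n x \<partial>M)"
  using assms
proof (induction n arbitrary: f)
  case (Suc n)
  have "T f \<in> borel_measurable M" using Suc.prems by simp
  then show ?case
    \<comment> \<open>The innermost \<open>T\<close> is peeled off, so that the hypothesis for
      \<open>T f\<close> leaves the weight \<open>Jn n\<close>, which then becomes
      \<open>Jn (Suc n)\<close> against \<open>sq f\<close>.\<close>
    using Suc.IH[of "T f"] nn_integral_J_wco[OF Suc.prems] by (simp add: funpow_swap1 del: J.simps)
qed simp

text \<open>Passing from \<open>f\<close> to \<open>T f\<close> raises the index of each weight by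
  one, and the weight \<open>J_0 = 1\<close> accounts for \<open>f\<close> itself. The domain thus
  becomes an intersection of weighted square-integrable spaces, in which test functions are easy to
  find.\<close>

lemma pow_dom_iff:
  "f \<in> D n \<longleftrightarrow> f \<in> borel_measurable M \<and> (\<forall>i\<le>n. (\<integral>\<^sup>+x. sq f x * Jn i x \<partial>M) < \<infinity>)"
proof (induction n arbitrary: f)
  case 0
  then show ?case by (simp add: L2_space_iff)
next
  case (Suc n)
  \<comment> \<open>The condition that \<open>wco_dom\<close> puts on \<open>T f\<close> is the
    weight \<open>J_0\<close> in \<open>T f \<in> D n\<close>.\<close>
  have "T f \<in> L2_space M" if "T f \<in> D n"
  proof -
    have "T f \<in> borel_measurable M" "(\<integral>\<^sup>+x. sq (T f) x * Jn 0 x \<partial>M) < \<infinity>"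
      using that unfolding Suc by blast+
    then show ?thesis by (simp add: L2_space_iff)
  qed
  then have "f \<in> D (Suc n) \<longleftrightarrow> f \<in> L2_space M \<and> T f \<in> D n"
    by (auto simp: wco_dom_def)
  also have "\<dots> \<longleftrightarrow> f \<in> borel_measurable M \<and> (\<integral>\<^sup>+x. sq f x * Jn 0 x \<partial>M) < \<infinity>
      \<and> (\<forall>i\<le>n. (\<integral>\<^sup>+x. sq f x * Jn (Suc i) x \<partial>M) < \<infinity>)"
    unfolding Suc
    by (cases "f \<in> borel_measurable M") (simp_all add: L2_space_iff nn_integral_J_wco del: J.simps(2))
  also have "\<dots> \<longleftrightarrow> f \<in> borel_measurable M \<and> (\<forall>i\<le>Suc n. (\<integral>\<^sup>+x. sq f x * Jn i x \<partial>M) < \<infinity>)"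
    by (simp only: less_Suc_eq_le[symmetric] All_less_Suc2)
  finally show ?case .
qed

section \<open>Alternating inequalities under integration and under the recursion\<close>

lemma
  assumes [measurable]: "F \<in> borel_measurable M"
  shows nn_integral_even_part: "(\<integral>\<^sup>+x. F x * even_part n (\<lambda>i. Jn (m + i) x) \<partial>M)
      = even_part n (\<lambda>i. \<integral>\<^sup>+x. F x * Jn (m + i) x \<partial>M)"
    and nn_integral_odd_part: "(\<integral>\<^sup>+x. F x * odd_part n (\<lambda>i. Jn (m + i) x) \<partial>M)
      = odd_part n (\<lambda>i. \<integral>\<^sup>+x. F x * Jn (m + i) x \<partial>M)"
  unfolding even_part_def odd_part_def
  by (simp_all add: sum_distrib_left mult.left_commute[of "F _"] nn_integral_sum nn_integral_cmult)

lemma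
  borel_measurable_even_part [measurable]: "(\<lambda>x. even_part n (\<lambda>i. Jn (m + i) x)) \<in> borel_measurable M"
  and borel_measurable_odd_part [measurable]: "(\<lambda>x. odd_part n (\<lambda>i. Jn (m + i) x)) \<in> borel_measurable M"
  unfolding even_part_def odd_part_def by measurable

text \<open>Membership in \<open>D n\<close> makes the integrals of \<open>sq f\<close> against
  \<open>Jn 0\<close>, ..., \<open>Jn n\<close> finite, as the passage from real sums to
  \<open>[0, \<infinity>]\<close> requires. The functions \<open>Jn i\<close> may still be infinite
  where \<open>f\<close> vanishes.\<close>

lemma Theta_le_0_iff:
  assumes "f \<in> D n"
  shows "Theta (L2_norm M) T n f \<le> 0 \<longleftrightarrow>
    (\<integral>\<^sup>+x. sq f x * even_part n (\<lambda>i. Jn i x) \<partial>M) \<le> (\<integral>\<^sup>+x. sq f x * odd_part n (\<lambda>i. Jn i x) \<partial>M)"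
proof -
  have f [measurable]: "f \<in> borel_measurable M"
    and fin: "\<And>i. i \<le> n \<Longrightarrow> (\<integral>\<^sup>+x. sq f x * Jn i x \<partial>M) < \<infinity>"
    using assms by (auto simp: pow_dom_iff)
  have "Theta (L2_norm M) T n f
      = (\<Sum>i\<le>n. (-1) ^ i * real (n choose i) * enn2real (\<integral>\<^sup>+x. sq f x * Jn i x \<partial>M))"
    unfolding Theta_def using nn_integral_wco_funpow[OF f] by (simp add: L2_norm_sq)
  then show ?thesis
    using alternating_sum_le_0_iff[of n "\<lambda>i. \<integral>\<^sup>+x. sq f x * Jn i x \<partial>M"] fin
      nn_integral_even_part[of "sq f" n 0] nn_integral_odd_part[of "sq f" n 0] by simp
qed

text \<open>Integrating \<open>Jn (Suc m + i)\<close> over \<open>A\<close> is integrating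
  \<open>Jn (m + i)\<close> against a nonnegative \<open>?F\<close> that is the same for all
  \<open>i\<close>. The inequality at level \<open>m\<close>, integrated against \<open>?F\<close>,
  is therefore the one at level \<open>Suc m\<close> tested on \<open>A\<close>.\<close>

lemma even_part_le_odd_part_Suc:
  assumes le: "AE x in M. even_part n (\<lambda>i. Jn (m + i) x) \<le> odd_part n (\<lambda>i. Jn (m + i) x)"
  shows "AE x in M. even_part n (\<lambda>i. Jn (Suc m + i) x) \<le> odd_part n (\<lambda>i. Jn (Suc m + i) x)"
proof (rule AE_le_nn_integralI)
  fix A assume [measurable]: "A \<in> sets M"
  let ?F = "\<lambda>x. indicator A (\<phi> x) * sq u x"
  have J: "(\<integral>\<^sup>+x. indicator A x * Jn (Suc m + i) x \<partial>M) = (\<integral>\<^sup>+x. ?F x * Jn (m + i) x \<partial>M)" for i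
    using nn_integral_J_Suc[of "indicator A" "m + i"] by (simp add: ac_simps del: J.simps)
  have "(\<integral>\<^sup>+x. ?F x * even_part n (\<lambda>i. Jn (m + i) x) \<partial>M) \<le> (\<integral>\<^sup>+x. ?F x * odd_part n (\<lambda>i. Jn (m + i) x) \<partial>M)"
    by (rule nn_integral_mono_AE) (use le in \<open>auto intro!: mult_left_mono\<close>)
  then show "(\<integral>\<^sup>+x. indicator A x * even_part n (\<lambda>i. Jn (Suc m + i) x) \<partial>M)
      \<le> (\<integral>\<^sup>+x. indicator A x * odd_part n (\<lambda>i. Jn (Suc m + i) x) \<partial>M)"
    by (simp add: nn_integral_even_part nn_integral_odd_part J del: J.simps add_Suc)
qed measurable

lemma even_part_le_odd_part_shift:
  assumes "AE x in M. even_part n (\<lambda>i. Jn i x) \<le> odd_part n (\<lambda>i. Jn i x)"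
  shows "AE x in M. even_part n (\<lambda>i. Jn (m + i) x) \<le> odd_part n (\<lambda>i. Jn (m + i) x)"
proof (induction m)
  case 0
  then show ?case using assms by simp
next
  case (Suc m)
  then show ?case by (rule even_part_le_odd_part_Suc)
qed

section \<open>Finiteness from density of a domain\<close>

text \<open>Every \<open>g\<close> in \<open>D n\<close> vanishes almost everywhere on a set
  \<open>B\<close> where \<open>Jn i\<close> is infinite, as \<open>sq g\<close> times
  \<open>Jn i\<close> is integrable. Its squared distance from the indicator of \<open>B\<close> is
  then at least the measure of \<open>B\<close>, so density forces that measure to be 0.\<close>

lemma AE_J_finite_of_dense:
  assumes dense: "L2_dense M (D n)" and "i \<le> n"
  shows "AE x in M. Jn i x < \<infinity>"
proof -
  \<comment> \<open>Cutting down to sets of finite measure puts the indicator of \<open>B\<close>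
    into \<open>L2_space M\<close>.\<close>
  obtain A :: "nat \<Rightarrow> 'a set" where A: "range A \<subseteq> sets M" "(\<Union>j. A j) = space M"
    "\<And>j. emeasure M (A j) \<noteq> \<infinity>" using sigma_finite by blast
  have "AE x in M. x \<in> A j \<longrightarrow> Jn i x < \<infinity>" for j
  proof -
    have [measurable]: "A j \<in> sets M" using A by auto
    define B where "B = {x \<in> A j \<inter> space M. Jn i x = \<infinity>}"
    have [measurable]: "B \<in> sets M" unfolding B_def by measurable
    have "emeasure M B \<le> emeasure M (A j)" by (rule emeasure_mono) (auto simp: B_def)
    also have "\<dots> < \<infinity>" using A(3)[of j] by (simp add: less_top)
    finally have finB: "emeasure M B < \<infinity>" .
    let ?f = "indicator B :: 'a \<Rightarrow> complex"
    have sqf: "sq ?f x = indicator B x" for x by (auto split: split_indicator)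
    have f: "?f \<in> L2_space M" using finB by (simp add: L2_space_iff sqf)
    have "emeasure M B \<le> ennreal e" if "e > 0" for e
    proof -
      have "D n \<subseteq> L2_space M"
      proof
        fix g assume "g \<in> D n"
        then have "g \<in> borel_measurable M" "(\<integral>\<^sup>+x. sq g x * Jn 0 x \<partial>M) < \<infinity>"
          unfolding pow_dom_iff by blast+
        then show "g \<in> L2_space M" by (simp add: L2_space_iff)
      qed
      from L2_dense_ennrealE[OF dense this f that]
      obtain g where g: "g \<in> D n" "(\<integral>\<^sup>+x. sq (\<lambda>x. ?f x - g x) x \<partial>M) < ennreal e" .
      then have [measurable]: "g \<in> borel_measurable M" and "(\<integral>\<^sup>+x. sq g x * Jn i x \<partial>M) < \<infinity>"
        using \<open>i \<le> n\<close> by (auto simp: pow_dom_iff)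
      then have "AE x in M. sq g x * Jn i x \<noteq> \<infinity>"
        by (intro nn_integral_noteq_infinite) auto
      then have "AE x in M. indicator B x \<le> sq (\<lambda>x. ?f x - g x) x"
        by eventually_elim (auto simp: B_def ennreal_mult_eq_top_iff split: split_indicator)
      then have "(\<integral>\<^sup>+x. indicator B x \<partial>M) \<le> (\<integral>\<^sup>+x. sq (\<lambda>x. ?f x - g x) x \<partial>M)"
        by (rule nn_integral_mono_AE)
      also have "\<dots> \<le> ennreal e" using g(2) by (rule less_imp_le)
      finally show ?thesis by (simp only: nn_integral_indicator[OF \<open>B \<in> sets M\<close>])
    qed
    then have "emeasure M B \<le> 0 + ennreal e" if "e > 0" for e
      using that by (simp only: add_0_left)
    then have "emeasure M B \<le> 0" by (rule ennreal_le_epsilon)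
    then have "emeasure M B = 0" by simp
    then have "AE x in M. x \<notin> B" by (intro AE_not_in) (auto simp: null_sets_def)
    with AE_space show ?thesis
      by eventually_elim (auto simp: B_def less_top)
  qed
  then have "AE x in M. \<forall>j. x \<in> A j \<longrightarrow> Jn i x < \<infinity>"
    unfolding AE_all_countable by blast
  with AE_space show ?thesis
    by eventually_elim (use A(2) in blast)
qed

section \<open>From test functions to pointwise inequalities\<close>

text \<open>The pointwise inequality integrates against \<open>sq f\<close>. Conversely, indicators
  of measurable subsets of \<open>B j\<close> lie in \<open>D n\<close>, and by \<open>fin\<close>
  the sets \<open>B j\<close> cover almost all of the space.\<close>

lemma AE_even_part_le_odd_part_iff:
  assumes fin: "\<And>i. i \<le> n \<Longrightarrow> AE x in M. Jn i x < \<infinity>"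
  shows "(\<forall>f\<in>D n. Theta (L2_norm M) T n f \<le> 0) \<longleftrightarrow>
    (AE x in M. even_part n (\<lambda>i. Jn i x) \<le> odd_part n (\<lambda>i. Jn i x))"
proof
  assume "AE x in M. even_part n (\<lambda>i. Jn i x) \<le> odd_part n (\<lambda>i. Jn i x)"
  then show "\<forall>f\<in>D n. Theta (L2_norm M) T n f \<le> 0"
    by (auto simp: Theta_le_0_iff intro!: nn_integral_mono_AE mult_left_mono)
next
  assume Theta: "\<forall>f\<in>D n. Theta (L2_norm M) T n f \<le> 0"
  obtain A :: "nat \<Rightarrow> 'a set" where A: "range A \<subseteq> sets M" "(\<Union>j. A j) = space M"
    "\<And>j. emeasure M (A j) \<noteq> \<infinity>" "incseq A" using sigma_finite_incseq by blast
  \<comment> \<open>One index \<open>j\<close> controls both the measure of \<open>A j\<close> and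
    the size of the weights; as \<open>A\<close> increases, the larger of two indices meets both
    demands.\<close>
  define B where "B j = {x \<in> A j \<inter> space M. \<forall>i\<le>n. Jn i x \<le> of_nat j}" for j
  have [measurable]: "A j \<in> sets M" for j using A by auto
  have [measurable]: "B j \<in> sets M" for j unfolding B_def by measurable
  let ?P = "\<lambda>x. even_part n (\<lambda>i. Jn (0 + i) x)" and ?Q = "\<lambda>x. odd_part n (\<lambda>i. Jn (0 + i) x)"
  have "AE x in M. indicator (B j) x * ?P x \<le> indicator (B j) x * ?Q x" for j
  proof (rule AE_le_nn_integralI)
    fix C assume [measurable]: "C \<in> sets M"
    let ?f = "indicator (C \<inter> B j) :: 'a \<Rightarrow> complex"
    have sqf: "sq ?f x = indicator (C \<inter> B j) x" for x by (auto split: split_indicator)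
    have "(\<integral>\<^sup>+x. sq ?f x * Jn i x \<partial>M) < \<infinity>" if "i \<le> n" for i
    proof -
      have "(\<integral>\<^sup>+x. sq ?f x * Jn i x \<partial>M) \<le> (\<integral>\<^sup>+x. of_nat j * indicator (A j) x \<partial>M)"
        unfolding sqf using that by (intro nn_integral_mono) (auto simp: B_def split: split_indicator)
      also have "\<dots> = of_nat j * emeasure M (A j)" by (simp add: nn_integral_cmult)
      also have "\<dots> < \<infinity>" using A(3)[of j] by (auto simp: ennreal_mult_less_top of_nat_less_top less_top)
      finally show ?thesis .
    qed
    then have "?f \<in> D n" by (auto simp: pow_dom_iff)
    with Theta have "Theta (L2_norm M) T n ?f \<le> 0" by blast
    then have "(\<integral>\<^sup>+x. indicator (C \<inter> B j) x * ?P x \<partial>M) \<le> (\<integral>\<^sup>+x. indicator (C \<inter> B j) x * ?Q x \<partial>M)"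
      using Theta_le_0_iff[OF \<open>?f \<in> D n\<close>] unfolding sqf by simp
    then show "(\<integral>\<^sup>+x. indicator C x * (indicator (B j) x * ?P x) \<partial>M)
        \<le> (\<integral>\<^sup>+x. indicator C x * (indicator (B j) x * ?Q x) \<partial>M)"
      by (simp add: indicator_inter_arith ac_simps)
  qed measurable
  then have "AE x in M. \<forall>j. indicator (B j) x * ?P x \<le> indicator (B j) x * ?Q x"
    by (simp add: AE_all_countable)
  moreover have "AE x in M. \<forall>i\<in>{..n}. Jn i x < \<infinity>"
    using fin by (intro AE_ball_countable[THEN iffD2]) (auto simp: countable_finite)
  ultimately show "AE x in M. even_part n (\<lambda>i. Jn i x) \<le> odd_part n (\<lambda>i. Jn i x)"
    using AE_space
  proof eventually_elim
    case (elim x)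
    from elim(3) A(2) obtain j0 where j0: "x \<in> A j0" by blast
    \<comment> \<open>A single finite bound for all the weights at \<open>x\<close>.\<close>
    define c where "c = (\<Sum>i\<le>n. Jn i x)"
    have "c < \<infinity>" unfolding c_def using elim(2) by (simp add: ennreal_sum_less_top)
    then obtain j1 :: nat where j1: "c \<le> of_nat j1"
      by (metis ennreal_Ex_less_of_nat infinity_ennreal_def less_imp_le)
    have "x \<in> B (max j0 j1)"
      unfolding B_def
    proof (safe)
      show "x \<in> A (max j0 j1)" using j0 A(4) by (meson incseqD max.cobounded1 subsetD)
      show "x \<in> space M" by fact
      fix i assume "i \<le> n"
      then have "Jn i x \<le> c" unfolding c_def by (intro member_le_sum) auto
      also have "\<dots> \<le> of_nat (max j0 j1)" using j1 by (rule order_trans) simp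
      finally show "Jn i x \<le> of_nat (max j0 j1)" .
    qed
    with elim(1)[rule_format, of "max j0 j1"] show ?case by simp
  qed
qed

lemma AE_triangle_J_le_0_iff:
  assumes fin: "\<And>i. i \<le> n \<Longrightarrow> AE x in M. Jn i x < \<infinity>"
  shows "(AE x in M. triangle_J M u \<phi> n x \<le> 0) \<longleftrightarrow>
    (AE x in M. even_part n (\<lambda>i. Jn i x) \<le> odd_part n (\<lambda>i. Jn i x))"
proof (rule eventually_cong)
  show "AE x in M. \<forall>i\<in>{..n}. Jn i x < \<infinity>"
    using fin by (intro AE_ball_countable[THEN iffD2]) (auto simp: countable_finite)
  show "triangle_J M u \<phi> n x \<le> 0 \<longleftrightarrow> even_part n (\<lambda>i. Jn i x) \<le> odd_part n (\<lambda>i. Jn i x)"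
    if "\<forall>i\<in>{..n}. Jn i x < \<infinity>" for x
    unfolding triangle_J_def using that by (intro alternating_sum_le_0_iff) auto
qed

section \<open>Finiteness of every \<open>Jn n\<close>\<close>

text \<open>The second-order inequality shifted by \<open>m\<close> bounds \<open>Jn (m + 2)\<close>
  by twice \<open>Jn (m + 1)\<close>, so finiteness spreads upwards from
  \<open>Jn 1\<close>.\<close>

lemma AE_J_finite:
  assumes "AE x in M. Jn 1 x < \<infinity>"
    and le: "AE x in M. even_part 2 (\<lambda>i. Jn i x) \<le> odd_part 2 (\<lambda>i. Jn i x)"
  shows "AE x in M. Jn n x < \<infinity>"
proof (induction n rule: less_induct)
  case (less n)
  show ?case
  proof (cases "n \<le> 1")
    case True
    then consider "n = 0" | "n = 1" by linarith
    then show ?thesis by cases (use assms in auto)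
  next
    case False
    then obtain m where n: "n = m + 2" by (metis add.commute le_Suc_ex not_less_eq_eq numeral_2_eq_2 One_nat_def)
    have "AE x in M. Jn (m + 1) x < \<infinity>" by (rule less) (simp add: n)
    moreover have "AE x in M. even_part 2 (\<lambda>i. Jn (m + i) x) \<le> odd_part 2 (\<lambda>i. Jn (m + i) x)"
      by (rule even_part_le_odd_part_shift[OF le])
    ultimately show ?thesis
    proof eventually_elim
      case (elim x)
      have E: "{i::nat. i \<le> 2 \<and> even i} = {0, 2}" "{i::nat. i \<le> 2 \<and> odd i} = {1}"
        by (auto simp: le_Suc_eq numeral_2_eq_2)
      have "Jn (m + 2) x \<le> Jn m x + Jn (m + 2) x" by simp
      also have "\<dots> \<le> 2 * Jn (m + 1) x"
        using elim(2) by (simp add: even_part_def odd_part_def E del: J.simps)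
      also have "\<dots> < \<infinity>" using elim(1) by (simp add: ennreal_mult_less_top del: J.simps)
      finally show ?case by (simp add: n)
    qed
  qed
qed

end

theorem theorem2p12:
  fixes M :: "'a measure" and u :: "'a \<Rightarrow> complex" and \<phi> :: "'a \<Rightarrow> 'a" and k :: nat
  assumes "sigma_finite_measure M"
    and "u \<in> borel_measurable M"
    and "\<phi> \<in> measurable M M"
    and "absolutely_continuous M (distr M M \<phi>)"
    and "sigma_finite_measure (restr_to_subalg M (preimage_algebra M \<phi>))"
    and "L2_dense M (pow_dom (L2_space M) (wco_dom M u \<phi>) (wco u \<phi>) 2)"
    and "k \<ge> 1"
  shows "(k_hyperexpansive (L2_space M) (L2_norm M) (wco_dom M u \<phi>) (wco u \<phi>) k \<longleftrightarrow>
            (\<forall>i\<in>{1..k}. triangle_J_defined M u \<phi> i \<and> (AE x in M. triangle_J M u \<phi> i x \<le> 0)))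
       \<and> (completely_hyperexpansive (L2_space M) (L2_norm M) (wco_dom M u \<phi>) (wco u \<phi>) \<longleftrightarrow>
            (AE x in M. (\<forall>i. J M u \<phi> i x < \<infinity>) \<and>
               completely_alternating (\<lambda>i. enn2real (J M u \<phi> i x))))"
proof -
  interpret weighted_composition M u \<phi>
    using assms(1-5) by (rule weighted_composition.intro)
  have fin2: "AE x in M. Jn i x < \<infinity>" if "i \<le> 2" for i
    using AE_J_finite_of_dense[OF assms(6) that] .
  \<comment> \<open>Density settles the indices up to 2, which is what turns the condition on
    \<open>Theta\<close> of order 2 into a pointwise inequality.\<close>
  have fin_all: "AE x in M. Jn i x < \<infinity>" if "\<forall>f\<in>D 2. Theta (L2_norm M) T 2 f \<le> 0" for i
  proof (rule AE_J_finite)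
    show "AE x in M. Jn 1 x < \<infinity>" by (rule fin2) simp
    show "AE x in M. even_part 2 (\<lambda>i. Jn i x) \<le> odd_part 2 (\<lambda>i. Jn i x)"
      using AE_even_part_le_odd_part_iff[of 2, OF fin2] that by simp
  qed
  have "k_hyperexpansive (L2_space M) (L2_norm M) (wco_dom M u \<phi>) T k \<longleftrightarrow>
      (\<forall>i\<in>{1..k}. triangle_J_defined M u \<phi> i \<and> (AE x in M. triangle_J M u \<phi> i x \<le> 0))"
  proof
    assume hyp: "k_hyperexpansive (L2_space M) (L2_norm M) (wco_dom M u \<phi>) T k"
    then have Theta: "\<forall>f\<in>D i. Theta (L2_norm M) T i f \<le> 0" if "i \<in> {1..k}" for i
      using that by (auto simp: k_hyperexpansive_def)
    have fin: "AE x in M. Jn i x < \<infinity>" if "i \<le> k" for i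
    \<comment> \<open>For \<open>k = 1\<close> no condition of order 2 is at hand, and density gives
      \<open>Jn 1\<close> directly; for larger \<open>k\<close> the condition of order 2 gives all
      indices.\<close>
    proof (cases "k = 1")
      case True
      then show ?thesis using that by (intro fin2) simp
    next
      case False
      then show ?thesis using assms(7) by (intro fin_all Theta) simp
    qed
    show "\<forall>i\<in>{1..k}. triangle_J_defined M u \<phi> i \<and> (AE x in M. triangle_J M u \<phi> i x \<le> 0)"
    proof
      fix i assume i: "i \<in> {1..k}"
      then have fin_i: "AE x in M. Jn j x < \<infinity>" if "j \<le> i" for j
        using that by (intro fin) simp
      then show "triangle_J_defined M u \<phi> i \<and> (AE x in M. triangle_J M u \<phi> i x \<le> 0)"
        using AE_triangle_J_le_0_iff[of i, OF fin_i] AE_even_part_le_odd_part_iff[of i, OF fin_i] Theta[OF i]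
        by (simp add: triangle_J_defined_def)
    qed
  next
    assume tri: "\<forall>i\<in>{1..k}. triangle_J_defined M u \<phi> i \<and> (AE x in M. triangle_J M u \<phi> i x \<le> 0)"
    have "\<forall>f\<in>D n. Theta (L2_norm M) T n f \<le> 0" if n: "n \<in> {1..k}" for n
    proof -
      have fin: "AE x in M. Jn j x < \<infinity>" if "j \<le> n" for j
      \<comment> \<open>\<open>triangle_J_defined\<close> speaks of indices from 1 on;
        \<open>Jn 0\<close> is the constant 1.\<close>
      proof (cases "j = 0")
        case False
        have "triangle_J_defined M u \<phi> n" using tri n by blast
        then show ?thesis using False that by (auto simp: triangle_J_defined_def)
      qed simp
      show ?thesis
        using AE_triangle_J_le_0_iff[of n, OF fin] AE_even_part_le_odd_part_iff[of n, OF fin] tri n by simp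
    qed
    then show "k_hyperexpansive (L2_space M) (L2_norm M) (wco_dom M u \<phi>) T k"
      by (auto simp: k_hyperexpansive_def)
  qed
  moreover have "completely_hyperexpansive (L2_space M) (L2_norm M) (wco_dom M u \<phi>) T \<longleftrightarrow>
      (AE x in M. (\<forall>i. Jn i x < \<infinity>) \<and> completely_alternating (\<lambda>i. enn2real (Jn i x)))"
  proof
    assume "completely_hyperexpansive (L2_space M) (L2_norm M) (wco_dom M u \<phi>) T"
    then have Theta: "\<forall>f\<in>D n. Theta (L2_norm M) T n f \<le> 0" if "n \<ge> 1" for n
      using that by (auto simp: completely_hyperexpansive_def)
    have fin: "AE x in M. Jn i x < \<infinity>" for i
      by (rule fin_all) (simp add: Theta)
    \<comment> \<open>The operator condition gives only \<open>m = 0\<close>; the recursion carries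
      it to every \<open>m\<close>. There are countably many pairs of \<open>m\<close> and
      \<open>n\<close>, so one null set serves them all.\<close>
    have "AE x in M. even_part n (\<lambda>i. Jn (m + i) x) \<le> odd_part n (\<lambda>i. Jn (m + i) x)"
      if "n \<ge> 1" for m n
      using AE_even_part_le_odd_part_iff[of n, OF fin] Theta[OF that]
      by (intro even_part_le_odd_part_shift) simp
    then have "AE x in M. \<forall>m n. n \<ge> 1 \<longrightarrow> even_part n (\<lambda>i. Jn (m + i) x) \<le> odd_part n (\<lambda>i. Jn (m + i) x)"
      by (simp add: AE_all_countable)
    moreover have "AE x in M. \<forall>i. Jn i x < \<infinity>"
      using fin by (simp add: AE_all_countable)
    ultimately show "AE x in M. (\<forall>i. Jn i x < \<infinity>) \<and> completely_alternating (\<lambda>i. enn2real (Jn i x))"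
      by eventually_elim (simp add: completely_alternating_def alternating_sum_le_0_iff)
  next
    assume alt: "AE x in M. (\<forall>i. Jn i x < \<infinity>) \<and> completely_alternating (\<lambda>i. enn2real (Jn i x))"
    then have fin: "AE x in M. Jn i x < \<infinity>" for i by eventually_elim simp
    have "\<forall>f\<in>D n. Theta (L2_norm M) T n f \<le> 0" if "n \<ge> 1" for n
    proof -
      \<comment> \<open>This is the case \<open>m = 0\<close> of complete alternation.\<close>
      have "AE x in M. triangle_J M u \<phi> n x \<le> 0"
        using alt
      proof eventually_elim
        case (elim x)
        then have "(\<Sum>i\<le>n. (-1) ^ i * real (n choose i) * enn2real (Jn (0 + i) x)) \<le> 0"
          unfolding completely_alternating_def using that by blast
        then show ?case by (simp add: triangle_J_def)
      qed
      then show ?thesis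
        using AE_triangle_J_le_0_iff[of n, OF fin] AE_even_part_le_odd_part_iff[of n, OF fin] by simp
    qed
    then show "completely_hyperexpansive (L2_space M) (L2_norm M) (wco_dom M u \<phi>) T"
      by (auto simp: completely_hyperexpansive_def)
  qed
  ultimately show ?thesis ..
qed

end
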